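(* For $k\ge3$ the quiver with relations $V_k$ is wild.
   Context: The ground field is $\mathbb{C}$. The quiver with relations $V_k$: its vertices are the vertices of the cube in $\mathbb{R}^k$ with coordinates $1$ or $-1$; its arrows are the edges of the cube, each taken with both possible orientations. A path is called admissible if each coordinate function is weakly monotonic along the path. The relations are: each non-admissible path is zero, and every two admissible paths with the same starting point and the same end point are equal. "Wild" means of wild representation type in the usual sense. *)

theory Defs
  imports
    "Graph_Theory.Arc_Walk"
    "Jordan_Normal_Form.Matrix"
    "HOL-Library.Poly_Mapping"
    Complex_Main
begin

section \<open>Representations of quivers with relations\<close>

text \<open>
  A quiver is a digraph \<open>G\<close>; its paths from \<open>u\<close> to \<open>v\<close> are the arc walks \<open>p\<close> with
  \<open>awalk u p v\<close>, listed in order of travel, the empty list being the trivial path.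
  A triple \<open>(u, r, v)\<close> is a relation: \<open>r\<close> is a complex linear combination of paths from
  \<open>u\<close> to \<open>v\<close>, required to act as zero.
\<close>

type_synonym ('v, 'a) relations = "('v \<times> ('a list \<Rightarrow>\<^sub>0 complex) \<times> 'v) set"

text \<open>
  Over a coefficient ring \<open>R\<close>, \<open>V\<close> puts the free right module \<open>R\<^sup>d\<close> with \<open>d = rdim V v\<close> at \<open>v\<close>, and
  arrows act on column vectors by left multiplication with matrices.
  Values outside the vertices and arrows of the quiver are irrelevant.
\<close>

record ('v, 'a, 'r) rep =
  rdim :: "'v \<Rightarrow> nat"
  rmap :: "'a \<Rightarrow> 'r mat"

primrec path_mat ::
  "('v, 'a) pre_digraph \<Rightarrow> ('v, 'a, 'r::semiring_1) rep \<Rightarrow> 'v \<Rightarrow> 'a list \<Rightarrow> 'r mat" where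
  "path_mat G V u [] = 1\<^sub>m (rdim V u)"
| "path_mat G V u (a # p) = path_mat G V (head G a) p * rmap V a"

text \<open>The parameter \<open>scale\<close> is the action of the ground field on the coefficient ring.\<close>

definition is_rep ::
  "(complex \<Rightarrow> 'r \<Rightarrow> 'r) \<Rightarrow> ('v, 'a) pre_digraph \<Rightarrow> ('v, 'a) relations \<Rightarrow>
    ('v, 'a, 'r::semiring_1) rep \<Rightarrow> bool" where
  "is_rep scale G R V \<longleftrightarrow>
    (\<forall>a\<in>arcs G. rmap V a \<in> carrier_mat (rdim V (head G a)) (rdim V (tail G a))) \<and>
    (\<forall>(u, r, v)\<in>R. \<forall>i<rdim V v. \<forall>j<rdim V u.
      (\<Sum>p\<in>Poly_Mapping.keys r. scale (Poly_Mapping.lookup r p) (path_mat G V u p $$ (i, j))) = 0)"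

abbreviation is_crep ::
  "('v, 'a) pre_digraph \<Rightarrow> ('v, 'a) relations \<Rightarrow> ('v, 'a, complex) rep \<Rightarrow> bool" where
  "is_crep \<equiv> is_rep times"

definition iso_rep ::
  "('v, 'a) pre_digraph \<Rightarrow> ('v, 'a, complex) rep \<Rightarrow> ('v, 'a, complex) rep \<Rightarrow> bool" where
  "iso_rep G V W \<longleftrightarrow> (\<exists>\<phi>.
    (\<forall>v\<in>verts G. \<phi> v \<in> carrier_mat (rdim W v) (rdim V v) \<and> invertible_mat (\<phi> v)) \<and>
    (\<forall>a\<in>arcs G. \<phi> (head G a) * rmap V a = rmap W a * \<phi> (tail G a)))"

definition zero_rep :: "('v, 'a) pre_digraph \<Rightarrow> ('v, 'a, complex) rep \<Rightarrow> bool" where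
  "zero_rep G V \<longleftrightarrow> (\<forall>v\<in>verts G. rdim V v = 0)"

definition dsum_rep ::
  "('v, 'a, complex) rep \<Rightarrow> ('v, 'a, complex) rep \<Rightarrow> ('v, 'a, complex) rep" where
  "dsum_rep V W = \<lparr>rdim = \<lambda>v. rdim V v + rdim W v,
                   rmap = \<lambda>a. diag_block_mat [rmap V a, rmap W a]\<rparr>"

definition indecomposable_rep ::
  "('v, 'a) pre_digraph \<Rightarrow> ('v, 'a) relations \<Rightarrow> ('v, 'a, complex) rep \<Rightarrow> bool" where
  "indecomposable_rep G R U \<longleftrightarrow> \<not> zero_rep G U \<and>
    (\<forall>V W. is_crep G R V \<longrightarrow> is_crep G R W \<longrightarrow> iso_rep G U (dsum_rep V W) \<longrightarrow>
      zero_rep G V \<or> zero_rep G W)"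

section \<open>The free algebra in two generators\<close>

text \<open>
  The free monoid on \<open>x\<close>, \<open>y\<close> is written additively, since \<^typ>\<open>'m \<Rightarrow>\<^sub>0 complex\<close> carries the
  monoid algebra product for an additive monoid \<open>'m\<close>, commutative or not.
\<close>

datatype letter = X_gen | Y_gen

datatype free_word = Free_Word (letters: "letter list")

instantiation free_word :: monoid_add
begin

definition "0 = Free_Word []"

definition "v + w = Free_Word (letters v @ letters w)"

instance
  by standard (simp_all add: zero_free_word_def plus_free_word_def)

end

type_synonym free_alg = "free_word \<Rightarrow>\<^sub>0 complex"

abbreviation free_scale :: "complex \<Rightarrow> free_alg \<Rightarrow> free_alg" where
  "free_scale c \<equiv> Poly_Mapping.map (times c)"

text \<open>
  Finite-dimensional left modules over the free algebra are the representations of the quiver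
  with one vertex, two loops and no relations.
\<close>

definition two_loops :: "(unit, letter) pre_digraph" where
  "two_loops = \<lparr>verts = UNIV, arcs = UNIV, tail = \<lambda>_. (), head = \<lambda>_. ()\<rparr>"

primrec word_mat :: "(unit, letter, complex) rep \<Rightarrow> letter list \<Rightarrow> complex mat" where
  "word_mat N [] = 1\<^sub>m (rdim N ())"
| "word_mat N (l # w) = rmap N l * word_mat N w"

definition free_eval :: "(unit, letter, complex) rep \<Rightarrow> free_alg \<Rightarrow> complex mat" where
  "free_eval N f = mat (rdim N ()) (rdim N ())
    (\<lambda>ij. \<Sum>w\<in>Poly_Mapping.keys f. Poly_Mapping.lookup f w * word_mat N (letters w) $$ ij)"

section \<open>Wild representation type\<close>

text \<open>
  A representation \<open>M\<close> over the free algebra \<open>F\<close> is a bimodule (quiver algebra on the left,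
  \<open>F\<close> on the right) that is finitely generated and free over \<open>F\<close>. Tensoring
  with a left \<open>F\<close>-module \<open>N\<close> puts \<open>F\<^sup>d \<otimes> N = N\<^sup>d\<close> at each vertex and replaces each matrix entry by
  the block through which it acts on \<open>N\<close>.
\<close>

definition tensor_rep ::
  "('v, 'a, free_alg) rep \<Rightarrow> (unit, letter, complex) rep \<Rightarrow>
    ('v, 'a, complex) rep" where
  "tensor_rep M N = (let n = rdim N () in
    \<lparr>rdim = \<lambda>v. rdim M v * n,
     rmap = \<lambda>a. mat (dim_row (rmap M a) * n) (dim_col (rmap M a) * n)
       (\<lambda>(i, j). free_eval N (rmap M a $$ (i div n, j div n)) $$ (i mod n, j mod n))\<rparr>)"

text \<open>
  Wildness: tensoring with some such bimodule preserves indecomposability and reflects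
  isomorphism, on finite-dimensional modules over the free algebra.
\<close>

definition wild :: "('v, 'a) pre_digraph \<Rightarrow> ('v, 'a) relations \<Rightarrow> bool" where
  "wild G R \<longleftrightarrow> (\<exists>M :: ('v, 'a, free_alg) rep. is_rep free_scale G R M \<and>
    (\<forall>N. is_crep two_loops {} N \<longrightarrow> indecomposable_rep two_loops {} N \<longrightarrow>
      indecomposable_rep G R (tensor_rep M N)) \<and>
    (\<forall>N N'. is_crep two_loops {} N \<longrightarrow> is_crep two_loops {} N' \<longrightarrow>
      iso_rep G (tensor_rep M N) (tensor_rep M N') \<longrightarrow> iso_rep two_loops N N'))"

section \<open>The quiver with relations of the cube\<close>

definition cube_verts :: "nat \<Rightarrow> real list set" where
  "cube_verts k = {u. length u = k \<and> set u \<subseteq> {1, -1}}"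

text \<open>The arrow \<open>(u, v)\<close> is the edge between \<open>u\<close> and \<open>v\<close>, oriented from \<open>u\<close> to \<open>v\<close>.\<close>

definition cube_quiver :: "nat \<Rightarrow> (real list, real list \<times> real list) pre_digraph" where
  "cube_quiver k = \<lparr>
    verts = cube_verts k,
    arcs = {(u, v). u \<in> cube_verts k \<and> v \<in> cube_verts k \<and> card {i. i < k \<and> u ! i \<noteq> v ! i} = 1},
    tail = fst,
    head = snd\<rparr>"

definition admissible :: "nat \<Rightarrow> real list \<Rightarrow> (real list \<times> real list) list \<Rightarrow> bool" where
  "admissible k u p \<longleftrightarrow> (\<forall>i<k.
    let cs = map (\<lambda>w. w ! i) (pre_digraph.awalk_verts (cube_quiver k) u p)
    in sorted_wrt (\<le>) cs \<or> sorted_wrt (\<ge>) cs)"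

definition cube_relations :: "nat \<Rightarrow> (real list, real list \<times> real list) relations" where
  "cube_relations k =
    {(u, Poly_Mapping.single p 1, v) | u p v.
      pre_digraph.awalk (cube_quiver k) u p v \<and> \<not> admissible k u p} \<union>
    {(u, Poly_Mapping.single p 1 - Poly_Mapping.single q 1, v) | u p q v.
      pre_digraph.awalk (cube_quiver k) u p v \<and> admissible k u p \<and>
      pre_digraph.awalk (cube_quiver k) u q v \<and> admissible k u q}"

end

theory Submission
  imports Defs
begin

text \<open>
  Write \<open>+\<close> and \<open>-\<close> for the coordinates \<open>1\<close> and \<open>-1\<close>. Two faces of the cube that share an edge
  span a bipartite graph with six vertices and seven edges, a ladder:

    \<open>-++  \<longrightarrow>  +++  \<longleftarrow>  +-+\<close>

    \<open> x\<down>       \<up>       \<down>y\<close>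

    \<open>-+-  \<longleftarrow>  ++-  \<longrightarrow>  +--\<close>

  Each edge of the ladder is given the orientation drawn above, so that three vertices are sources
  and three are sinks. Put the free module of rank one at these six vertices and \<open>0\<close> at all other
  vertices of the cube (for \<open>k > 3\<close> the further coordinates of the ladder are \<open>+\<close>), let the two
  marked arrows act as the free generators \<open>x\<close> and \<open>y\<close>, the other five as \<open>1\<close>, and all remaining
  arrows of the cube as \<open>0\<close>. This is the bimodule \<open>M\<close> that exhibits wildness.

  No arrow with nonzero action starts where another one ends, so every path of length at least
  two acts as \<open>0\<close>. All relations then hold: a non-admissible path has length at least two, and the
  length of an admissible path is the Hamming distance of its ends, so two distinct admissible
  paths with the same ends both have length at least two
  (\<open>is_rep_cube_if_radical_square_zero\<close>).

  The five arrows that act as \<open>1\<close> form a spanning tree of the ladder. A homomorphism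
  \<open>M \<otimes> N \<rightarrow> M \<otimes> N'\<close> is therefore given by one and the same matrix at all six vertices, and the
  remaining two arrows say that this matrix intertwines the actions of \<open>x\<close> and \<open>y\<close>: the functor
  \<open>M \<otimes> _\<close> is fully faithful (\<open>hom_tensor_ladder\<close>). Hence it reflects isomorphism. It preserves
  indecomposability because a decomposition of \<open>M \<otimes> N\<close> yields an idempotent endomorphism,
  which comes from an idempotent endomorphism of \<open>N\<close>
  (\<open>indecomposable_rep_if_endomorphisms_diagonal\<close>).
\<close>

section \<open>Homomorphisms of representations\<close>

definition rep_hom ::
  "('v, 'a) pre_digraph \<Rightarrow> ('v, 'a, complex) rep \<Rightarrow> ('v, 'a, complex) rep \<Rightarrow>
    ('v \<Rightarrow> complex mat) \<Rightarrow> bool" where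
  "rep_hom G V W f \<longleftrightarrow>
    (\<forall>v\<in>verts G. f v \<in> carrier_mat (rdim W v) (rdim V v)) \<and>
    (\<forall>a\<in>arcs G. f (head G a) * rmap V a = rmap W a * f (tail G a))"

lemma iso_rep_iff_rep_hom:
  "iso_rep G V W \<longleftrightarrow> (\<exists>f. rep_hom G V W f \<and> (\<forall>v\<in>verts G. invertible_mat (f v)))"
  unfolding iso_rep_def rep_hom_def by blast

lemma invertible_mat_obtain_inverse:
  fixes A :: "'r::semiring_1 mat"
  assumes "A \<in> carrier_mat m n" "invertible_mat A"
  obtains B where "m = n" "B \<in> carrier_mat n n" "A * B = 1\<^sub>m n" "B * A = 1\<^sub>m n"
proof -
  from assms(2) obtain B where sq: "dim_row A = dim_col A"
    and AB: "A * B = 1\<^sub>m (dim_row A)" and BA: "B * A = 1\<^sub>m (dim_row B)"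
    unfolding invertible_mat_def inverts_mat_def by auto
  have mn: "m = n" using sq assms(1) by auto
  have "dim_col B = n" using arg_cong[OF AB, of dim_col] assms(1) mn by simp
  moreover have "dim_row B = n" using arg_cong[OF BA, of dim_col] assms(1) by simp
  ultimately show thesis using that[of B] mn AB BA assms(1) by auto
qed

section \<open>The projection onto a block of coordinates\<close>

definition block_proj :: "nat \<Rightarrow> nat \<Rightarrow> complex mat" where
  "block_proj r s = four_block_mat (1\<^sub>m r) (0\<^sub>m r s) (0\<^sub>m s r) (0\<^sub>m s s)"

lemma block_proj_carrier [simp]: "block_proj r s \<in> carrier_mat (r + s) (r + s)"
  unfolding block_proj_def by simp

lemma block_proj_0_left: "block_proj 0 s = 0\<^sub>m s s"
  unfolding block_proj_def by (intro eq_matI) auto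

lemma block_proj_0_right: "block_proj r 0 = 1\<^sub>m r"
  unfolding block_proj_def by (intro eq_matI) auto

lemma block_proj_eq_0D:
  assumes "block_proj r s = 0\<^sub>m n n"
  shows "r = 0"
proof (rule ccontr)
  assume "r \<noteq> 0"
  have "r + s = n" using arg_cong[OF assms, of dim_row] by (simp add: block_proj_def)
  hence "block_proj r s $$ (0, 0) = 0" using assms \<open>r \<noteq> 0\<close> by simp
  thus False using \<open>r \<noteq> 0\<close> by (simp add: block_proj_def)
qed

lemma block_proj_eq_1D:
  assumes "block_proj r s = 1\<^sub>m n"
  shows "s = 0"
proof (rule ccontr)
  assume "s \<noteq> 0"
  have "r + s = n" using arg_cong[OF assms, of dim_row] by (simp add: block_proj_def)
  hence "block_proj r s $$ (r, r) = 1" using assms \<open>s \<noteq> 0\<close> by simp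
  thus False using \<open>s \<noteq> 0\<close> by (simp add: block_proj_def)
qed

lemma diag_block_mat_two:
  assumes "A \<in> carrier_mat m n" "B \<in> carrier_mat p q"
  shows "diag_block_mat [A, B] = four_block_mat A (0\<^sub>m m q) (0\<^sub>m p n) B"
  using assms by (intro eq_matI) (auto simp: Let_def)

lemma block_proj_commutes_diag_block:
  assumes A: "A \<in> carrier_mat r r'" and B: "B \<in> carrier_mat s s'"
  shows "block_proj r s * diag_block_mat [A, B] = diag_block_mat [A, B] * block_proj r' s'"
proof -
  have "block_proj r s * diag_block_mat [A, B] = four_block_mat A (0\<^sub>m r s') (0\<^sub>m s r') (0\<^sub>m s s')"
    unfolding block_proj_def diag_block_mat_two[OF A B]
    by (subst mult_four_block_mat[of _ r r _ s _ s _ _ r' _ s']) (use A B in auto)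
  also have "\<dots> = diag_block_mat [A, B] * block_proj r' s'"
    unfolding block_proj_def diag_block_mat_two[OF A B]
    by (subst mult_four_block_mat[of _ r r' _ s' _ s _ _ r' _ s']) (use A B in auto)
  finally show ?thesis .
qed

text \<open>
  Commuting with the projection means preserving both its image and its kernel, so the
  off-diagonal blocks vanish.
\<close>

lemma commutes_block_proj_obtain_blocks:
  assumes M: "M \<in> carrier_mat (r + s) (r + s)"
    and comm: "block_proj r s * M = M * block_proj r s"
  obtains A B where "A \<in> carrier_mat r r" "B \<in> carrier_mat s s" "M = diag_block_mat [A, B]"
proof -
  obtain A C D B where sp: "split_block M r r = (A, C, D, B)"
    by (cases "split_block M r r") auto
  have "dim_row M = r + s" "dim_col M = r + s" using M by auto
  note blocks = split_block[OF sp this]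
  have L: "block_proj r s * M = four_block_mat A C (0\<^sub>m s r) (0\<^sub>m s s)"
    unfolding block_proj_def blocks(5)
    by (subst mult_four_block_mat[of _ r r _ s _ s _ _ r _ s]) (use blocks(1-4) in auto)
  have R: "M * block_proj r s = four_block_mat A (0\<^sub>m r s) D (0\<^sub>m s s)"
    unfolding block_proj_def blocks(5)
    by (subst mult_four_block_mat[of _ r r _ s _ s _ _ r _ s]) (use blocks(1-4) in auto)
  have eq: "four_block_mat A C (0\<^sub>m s r) (0\<^sub>m s s) = four_block_mat A (0\<^sub>m r s) D (0\<^sub>m s s)"
    using L R comm by simp
  have "C = 0\<^sub>m r s"
  proof (intro eq_matI)
    fix i j assume "i < dim_row (0\<^sub>m r s)" "j < dim_col (0\<^sub>m r s)"
    thus "C $$ (i, j) = 0\<^sub>m r s $$ (i, j)"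
      using arg_cong[OF eq, of "\<lambda>X. X $$ (i, r + j)"] blocks(1-4) by auto
  qed (use blocks in auto)
  moreover have "D = 0\<^sub>m s r"
  proof (intro eq_matI)
    fix i j assume "i < dim_row (0\<^sub>m s r)" "j < dim_col (0\<^sub>m s r)"
    thus "D $$ (i, j) = 0\<^sub>m s r $$ (i, j)"
      using arg_cong[OF eq, of "\<lambda>X. X $$ (r + i, j)"] blocks(1-4) by auto
  qed (use blocks in auto)
  ultimately have "M = diag_block_mat [A, B]"
    using blocks by (simp add: diag_block_mat_two del: diag_block_mat.simps)
  thus thesis using that blocks by blast
qed

section \<open>Indecomposability from endomorphisms\<close>

lemma two_loops_simps [simp]:
  "verts two_loops = UNIV" "arcs two_loops = UNIV" "head two_loops l = ()" "tail two_loops l = ()"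
  unfolding two_loops_def by simp_all

lemma is_crep_two_loops:
  "is_crep two_loops {} N \<longleftrightarrow> (\<forall>l. rmap N l \<in> carrier_mat (rdim N ()) (rdim N ()))"
  unfolding is_rep_def by simp

text \<open>
  An idempotent endomorphism of an indecomposable module is \<open>0\<close> or \<open>1\<close>. The idempotent is given
  together with a base change \<open>P\<close> that makes it a coordinate projection; in the new coordinates
  the module is a direct sum with summands of dimensions \<open>r\<close> and \<open>s\<close>.
\<close>

lemma indecomposable_two_loops_commuting_proj:
  assumes N: "is_crep two_loops {} N" and ind: "indecomposable_rep two_loops {} N"
    and rs: "r + s = rdim N ()"
    and P: "P \<in> carrier_mat (r + s) (r + s)" and Q: "Q \<in> carrier_mat (r + s) (r + s)"
    and PQ: "P * Q = 1\<^sub>m (r + s)" and QP: "Q * P = 1\<^sub>m (r + s)"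
    and comm: "\<And>l. (Q * block_proj r s * P) * rmap N l = rmap N l * (Q * block_proj r s * P)"
  shows "r = 0 \<or> s = 0"
proof -
  let ?n = "r + s"
  let ?E = "block_proj r s"
  have Nl: "rmap N l \<in> carrier_mat ?n ?n" for l
    using N rs by (simp add: is_crep_two_loops)
  have E: "?E \<in> carrier_mat ?n ?n" by simp
  note [simp] = assoc_mult_mat[of _ ?n ?n _ ?n _ ?n] mult_carrier_mat[of _ ?n ?n _ ?n]
  have PQX: "P * (Q * X) = X" and QPX: "Q * (P * X) = X" if "X \<in> carrier_mat ?n ?n" for X
    using assoc_mult_mat[OF P Q that] assoc_mult_mat[OF Q P that] PQ QP that by simp_all
  have "\<exists>A B. A \<in> carrier_mat r r \<and> B \<in> carrier_mat s s \<and>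
      P * rmap N l * Q = diag_block_mat [A, B]" for l
  proof -
    have "?E * (P * rmap N l * Q) = P * ((Q * ?E * P) * rmap N l) * Q"
      using P Q E Nl[of l] by (simp add: PQX)
    also have "\<dots> = P * (rmap N l * (Q * ?E * P)) * Q"
      by (simp only: comm)
    also have "\<dots> = (P * rmap N l * Q) * ?E"
      using P Q E Nl[of l] PQ right_mult_one_mat[OF E] by simp
    finally have "?E * (P * rmap N l * Q) = (P * rmap N l * Q) * ?E" .
    thus ?thesis
      using commutes_block_proj_obtain_blocks[of "P * rmap N l * Q" r s] P Q Nl[of l]
      by (metis mult_carrier_mat)
  qed
  then obtain A B where A: "\<And>l. A l \<in> carrier_mat r r" and B: "\<And>l. B l \<in> carrier_mat s s"
    and AB: "\<And>l. P * rmap N l * Q = diag_block_mat [A l, B l]"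
    by metis
  define V :: "(unit, letter, complex) rep" where "V = \<lparr>rdim = \<lambda>_. r, rmap = A\<rparr>"
  define W :: "(unit, letter, complex) rep" where "W = \<lparr>rdim = \<lambda>_. s, rmap = B\<rparr>"
  have "is_crep two_loops {} V" "is_crep two_loops {} W"
    using A B by (simp_all add: is_crep_two_loops V_def W_def)
  moreover have "iso_rep two_loops N (dsum_rep V W)"
    unfolding iso_rep_def
  proof (intro exI[of _ "\<lambda>_. P"] conjI ballI)
    fix l
    have "P * rmap N l = (P * rmap N l * Q) * P"
      using P Q Nl[of l] QP by simp
    thus "P * rmap N l = rmap (dsum_rep V W) l * P"
      by (simp add: AB dsum_rep_def V_def W_def)
  next
    show "P \<in> carrier_mat (rdim (dsum_rep V W) v) (rdim N v)" for v
      using P rs by (simp add: dsum_rep_def V_def W_def)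
    show "invertible_mat P"
      unfolding invertible_mat_def inverts_mat_def using P Q PQ QP by auto
  qed
  ultimately have "zero_rep two_loops V \<or> zero_rep two_loops W"
    using ind unfolding indecomposable_rep_def by blast
  thus ?thesis by (simp add: zero_rep_def V_def W_def)
qed

text \<open>
  The hypotheses \<open>comm\<close> and \<open>diag\<close> express that an endomorphism of \<open>U\<close> is nothing but an
  endomorphism of \<open>N\<close>, repeated at each vertex of the support of \<open>U\<close>. An isomorphism \<open>p\<close> from \<open>U\<close>
  to \<open>V \<oplus> W\<close> transports the projection onto \<open>V\<close> to an idempotent endomorphism \<open>e\<close> of \<open>U\<close>. At the
  base vertex \<open>b\<close> it is an idempotent endomorphism of \<open>N\<close>, hence \<open>0\<close> or \<open>1\<close>, and by \<open>diag\<close> it is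
  then \<open>0\<close> or \<open>1\<close> at every vertex, which makes \<open>V\<close> or \<open>W\<close> zero.
\<close>

lemma indecomposable_rep_if_endomorphisms_diagonal:
  fixes U :: "('v, 'a, complex) rep"
  assumes arcs: "\<And>a. a \<in> arcs G \<Longrightarrow> head G a \<in> verts G \<and> tail G a \<in> verts G"
    and U: "\<And>a. a \<in> arcs G \<Longrightarrow> rmap U a \<in> carrier_mat (rdim U (head G a)) (rdim U (tail G a))"
    and N: "is_crep two_loops {} N" and ind: "indecomposable_rep two_loops {} N"
    and base: "b \<in> verts G" "rdim U b = rdim N ()"
    and supp: "\<And>v. v \<in> verts G \<Longrightarrow> rdim U v = 0 \<or> rdim U v = rdim N ()"
    and comm: "\<And>f l. rep_hom G U U f \<Longrightarrow> f b * rmap N l = rmap N l * f b"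
    and diag: "\<And>f v. rep_hom G U U f \<Longrightarrow> v \<in> verts G \<Longrightarrow> rdim U v \<noteq> 0 \<Longrightarrow> f v = f b"
  shows "indecomposable_rep G R U"
  unfolding indecomposable_rep_def
proof (intro conjI allI impI)
  have "rdim N () \<noteq> 0" using ind unfolding indecomposable_rep_def zero_rep_def by auto
  thus "\<not> zero_rep G U" using base unfolding zero_rep_def by metis
next
  fix V W
  assume V: "is_crep G R V" and W: "is_crep G R W" and "iso_rep G U (dsum_rep V W)"
  then obtain p where p: "rep_hom G U (dsum_rep V W) p"
    and inv: "\<And>v. v \<in> verts G \<Longrightarrow> invertible_mat (p v)"
    unfolding iso_rep_iff_rep_hom by blast
  have pc: "p v \<in> carrier_mat (rdim V v + rdim W v) (rdim U v)" if "v \<in> verts G" for v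
    using p that unfolding rep_hom_def dsum_rep_def by simp
  have "\<forall>v\<in>verts G. \<exists>B. rdim V v + rdim W v = rdim U v \<and> B \<in> carrier_mat (rdim U v) (rdim U v)
      \<and> p v * B = 1\<^sub>m (rdim U v) \<and> B * p v = 1\<^sub>m (rdim U v)"
    by (metis invertible_mat_obtain_inverse pc inv)
  then obtain q where
    dims: "\<And>v. v \<in> verts G \<Longrightarrow> rdim V v + rdim W v = rdim U v" and
    qc: "\<And>v. v \<in> verts G \<Longrightarrow> q v \<in> carrier_mat (rdim U v) (rdim U v)" and
    pq: "\<And>v. v \<in> verts G \<Longrightarrow> p v * q v = 1\<^sub>m (rdim U v)" and
    qp: "\<And>v. v \<in> verts G \<Longrightarrow> q v * p v = 1\<^sub>m (rdim U v)"
    by metis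
  let ?E = "\<lambda>v. block_proj (rdim V v) (rdim W v)"
  have pc': "p v \<in> carrier_mat (rdim U v) (rdim U v)" if "v \<in> verts G" for v
    using pc[OF that] dims[OF that] by simp
  have Ec: "?E v \<in> carrier_mat (rdim U v) (rdim U v)" if "v \<in> verts G" for v
    using dims[OF that] block_proj_carrier[of "rdim V v" "rdim W v"] by simp
  define e where "e v = q v * ?E v * p v" for v
  have ec: "e v \<in> carrier_mat (rdim U v) (rdim U v)" if "v \<in> verts G" for v
    unfolding e_def using qc[OF that] Ec[OF that] pc'[OF that] by auto
  have hom: "rep_hom G U U e"
    unfolding rep_hom_def
  proof (intro conjI ballI)
    fix a assume a: "a \<in> arcs G"
    let ?h = "head G a" and ?t = "tail G a"
    let ?m = "rdim U ?h" and ?n = "rdim U ?t"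
    have h: "?h \<in> verts G" and t: "?t \<in> verts G" using arcs[OF a] by auto
    define D where "D = diag_block_mat [rmap V a, rmap W a]"
    have Va: "rmap V a \<in> carrier_mat (rdim V ?h) (rdim V ?t)"
      and Wa: "rmap W a \<in> carrier_mat (rdim W ?h) (rdim W ?t)"
      using V W a unfolding is_rep_def by auto
    have D: "D \<in> carrier_mat ?m ?n"
      using four_block_carrier_mat[OF Va Wa] dims[OF h] dims[OF t]
      by (simp add: D_def diag_block_mat_two[OF Va Wa] del: diag_block_mat.simps)
    have comm1: "p ?h * rmap U a = D * p ?t"
      using p a unfolding rep_hom_def by (simp add: dsum_rep_def D_def)
    note car = pc'[OF h] pc'[OF t] qc[OF h] qc[OF t] Ec[OF h] Ec[OF t] U[OF a] D
    note as = assoc_mult_mat[of _ ?m ?m _ ?m _ ?n] assoc_mult_mat[of _ ?m ?m _ ?n _ ?n]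
      assoc_mult_mat[of _ ?m ?n _ ?n _ ?n] assoc_mult_mat[of _ ?m ?m _ ?m _ ?m]
      assoc_mult_mat[of _ ?n ?n _ ?n _ ?n] mult_carrier_mat[of _ ?m ?n _ ?n]
      mult_carrier_mat[of _ ?m ?m _ ?n] mult_carrier_mat[of _ ?m ?m _ ?m]
      mult_carrier_mat[of _ ?n ?n _ ?n]
    have DE: "?E ?h * D = D * ?E ?t"
      unfolding D_def by (rule block_proj_commutes_diag_block[OF Va Wa])
    have comm2: "q ?h * D = rmap U a * q ?t"
    proof -
      have "q ?h * D = q ?h * (D * p ?t) * q ?t"
        using car pq[OF t] by (simp add: as)
      also have "\<dots> = (q ?h * p ?h) * rmap U a * q ?t"
        unfolding comm1[symmetric] using car by (simp add: as)
      finally show ?thesis using car qp[OF h] by simp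
    qed
    \<comment> \<open>The projection onto \<open>V\<close> is an endomorphism of \<open>V \<oplus> W\<close>, and \<open>p\<close> is a homomorphism.\<close>
    have "e ?h * rmap U a = q ?h * ?E ?h * (p ?h * rmap U a)"
      unfolding e_def using car by (simp add: as)
    also have "\<dots> = q ?h * (?E ?h * D) * p ?t"
      unfolding comm1 using car by (simp add: as)
    also have "\<dots> = (q ?h * D) * ?E ?t * p ?t"
      unfolding DE using car by (simp add: as)
    also have "\<dots> = rmap U a * e ?t"
      unfolding comm2 e_def using car by (simp add: as)
    finally show "e ?h * rmap U a = rmap U a * e ?t" .
  qed (use ec in auto)
  have E_from_e: "?E v = p v * e v * q v" if v: "v \<in> verts G" for v
  proof -
    let ?n = "rdim U v"
    note car = pc'[OF v] qc[OF v] Ec[OF v]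
    note as = assoc_mult_mat[of _ ?n ?n _ ?n _ ?n] mult_carrier_mat[of _ ?n ?n _ ?n]
    have "p v * e v * q v = (p v * q v) * ?E v * (p v * q v)"
      unfolding e_def using car by (simp add: as)
    thus ?thesis using car pq[OF v] by simp
  qed
  have "rdim V b = 0 \<or> rdim W b = 0"
    using indecomposable_two_loops_commuting_proj[OF N ind, of "rdim V b" "rdim W b" "p b" "q b"]
      comm[OF hom] dims[OF base(1)] base pc'[OF base(1)] qc[OF base(1)] pq[OF base(1)]
      qp[OF base(1)]
    unfolding e_def by simp
  thus "zero_rep G V \<or> zero_rep G W"
  proof
    assume 0: "rdim V b = 0"
    hence eb: "e b = 0\<^sub>m (rdim N ()) (rdim N ())"
      using qc[OF base(1)] pc'[OF base(1)] base(2) dims[OF base(1)]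
      by (simp add: e_def block_proj_0_left)
    have "rdim V v = 0" if v: "v \<in> verts G" for v
    proof (cases "rdim U v = 0")
      case False
      hence "e v = 0\<^sub>m (rdim U v) (rdim U v)"
        using diag[OF hom v] eb supp[OF v] by simp
      hence "?E v = 0\<^sub>m (rdim U v) (rdim U v)"
        using E_from_e[OF v] pc'[OF v] qc[OF v] by simp
      thus ?thesis by (rule block_proj_eq_0D)
    qed (use dims[OF v] in simp)
    thus ?thesis unfolding zero_rep_def by blast
  next
    assume 0: "rdim W b = 0"
    hence eb: "e b = 1\<^sub>m (rdim N ())"
      using qc[OF base(1)] pc'[OF base(1)] base(2) dims[OF base(1)] qp[OF base(1)]
      by (simp add: e_def block_proj_0_right)
    have "rdim W v = 0" if v: "v \<in> verts G" for v
    proof (cases "rdim U v = 0")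
      case False
      hence "e v = 1\<^sub>m (rdim U v)"
        using diag[OF hom v] eb supp[OF v] by simp
      hence "?E v = 1\<^sub>m (rdim U v)"
        using E_from_e[OF v] pc'[OF v] qc[OF v] pq[OF v] by simp
      thus ?thesis by (rule block_proj_eq_1D)
    qed (use dims[OF v] in simp)
    thus ?thesis unfolding zero_rep_def by blast
  qed
qed

section \<open>Representations of the cube with radical square zero\<close>

lemma cube_quiver_simps [simp]:
  "verts (cube_quiver k) = cube_verts k" "tail (cube_quiver k) = fst" "head (cube_quiver k) = snd"
  unfolding cube_quiver_def by simp_all

lemma cube_arc_ends:
  "a \<in> arcs (cube_quiver k) \<Longrightarrow> snd a \<in> cube_verts k \<and> fst a \<in> cube_verts k"
  unfolding cube_quiver_def by auto

definition flips :: "real list \<Rightarrow> real list \<Rightarrow> nat \<Rightarrow> nat set" where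
  "flips u v k = {i. i < k \<and> u ! i \<noteq> v ! i}"

lemma cube_vert_nth: "u \<in> cube_verts k \<Longrightarrow> i < k \<Longrightarrow> u ! i = 1 \<or> u ! i = -1"
  unfolding cube_verts_def using nth_mem by fastforce

lemma cube_walk_in_verts:
  assumes "pre_digraph.cas (cube_quiver k) u p v" "set p \<subseteq> arcs (cube_quiver k)" "u \<in> cube_verts k"
  shows "v \<in> cube_verts k \<and> v \<in> set (pre_digraph.awalk_verts (cube_quiver k) u p)"
  using assms
proof (induction p arbitrary: u)
  case (Cons a p)
  thus ?case
    using Cons.IH[of "snd a"] cube_arc_ends[of a k]
    by (auto simp: pre_digraph.cas.simps pre_digraph.awalk_verts.simps)
qed (simp add: pre_digraph.cas.simps pre_digraph.awalk_verts.simps)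

text \<open>
  The first step of an admissible walk flips one coordinate; monotonicity forbids flipping it
  back, so this step adds exactly one to the set of coordinates in which the ends differ.
\<close>

lemma length_admissible_walk:
  assumes "pre_digraph.cas (cube_quiver k) u p v" "set p \<subseteq> arcs (cube_quiver k)"
    "u \<in> cube_verts k" "admissible k u p"
  shows "length p = card (flips u v k)"
  using assms
proof (induction p arbitrary: u)
  case Nil
  thus ?case by (simp add: pre_digraph.cas.simps flips_def)
next
  case (Cons a p)
  let ?ws = "\<lambda>w. pre_digraph.awalk_verts (cube_quiver k) w p"
  obtain w where a: "a = (u, w)"
    using Cons.prems(1) by (cases a) (simp add: pre_digraph.cas.simps)
  have cas: "pre_digraph.cas (cube_quiver k) w p v"
    using Cons.prems(1) a by (simp add: pre_digraph.cas.simps)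
  have w: "w \<in> cube_verts k" using Cons.prems(2) a cube_arc_ends[of a k] by simp
  have sub: "set p \<subseteq> arcs (cube_quiver k)" using Cons.prems(2) by simp
  have v: "v \<in> cube_verts k" "v \<in> set (?ws w)" using cube_walk_in_verts[OF cas sub w] by auto
  have adm: "admissible k w p"
    using Cons.prems(4) unfolding admissible_def Let_def a
    by (auto simp: pre_digraph.awalk_verts.simps)
  have IH: "length p = card (flips w v k)" by (rule Cons.IH[OF cas sub w adm])
  have "card (flips u w k) = 1"
    using Cons.prems(2) a unfolding flips_def cube_quiver_def by simp
  then obtain i where i: "flips u w k = {i}" by (auto simp: card_1_singleton_iff)
  have ik: "i < k" and iu: "u ! i \<noteq> w ! i" and other: "\<And>j. j < k \<Longrightarrow> j \<noteq> i \<Longrightarrow> u ! j = w ! j"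
    using i unfolding flips_def by auto
  have "w ! i = v ! i"
  proof -
    obtain ws where ws: "?ws w = w # ws"
      using cas by (cases p) (simp_all add: pre_digraph.cas.simps pre_digraph.awalk_verts.simps)
    have "sorted_wrt (\<le>) (u ! i # w ! i # map (\<lambda>w. w ! i) ws) \<or>
        sorted_wrt (\<ge>) (u ! i # w ! i # map (\<lambda>w. w ! i) ws)"
      using Cons.prems(4) ik ws unfolding admissible_def Let_def a
      by (simp add: pre_digraph.awalk_verts.simps)
    moreover have "v = w \<or> v \<in> set ws"
      using v(2) ws by simp
    ultimately have "u ! i \<le> w ! i \<and> w ! i \<le> v ! i \<or> u ! i \<ge> w ! i \<and> w ! i \<ge> v ! i"
      by auto
    thus ?thesis
      using cube_vert_nth[OF w ik] cube_vert_nth[OF v(1) ik]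
        cube_vert_nth[OF Cons.prems(3) ik] iu
      by auto
  qed
  moreover have "j \<in> flips u v k \<longleftrightarrow> j \<in> flips w v k" if "j \<noteq> i" for j
    using other[of j] that unfolding flips_def by auto
  moreover have "i \<in> flips u v k" and i_notin: "i \<notin> flips w v k"
    using ik iu \<open>w ! i = v ! i\<close> unfolding flips_def by auto
  ultimately have "flips u v k = insert i (flips w v k)"
    by (intro Set.set_eqI) (metis insert_iff)
  moreover have "finite (flips w v k)" unfolding flips_def by simp
  ultimately show ?case using IH i_notin by simp
qed

lemma admissible_walk_unique_if_short:
  assumes p: "pre_digraph.awalk (cube_quiver k) u p v" "admissible k u p"
    and q: "pre_digraph.awalk (cube_quiver k) u q v" "admissible k u q"
    and "length p \<le> 1"
  shows "p = q"
proof -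
  have "length p = length q"
    using length_admissible_walk[of k u p v] length_admissible_walk[of k u q v] p q
    by (simp add: pre_digraph.awalk_def)
  thus ?thesis
    using p(1) q(1) \<open>length p \<le> 1\<close>
    by (cases p; cases q) (auto simp: pre_digraph.awalk_def pre_digraph.cas.simps prod_eq_iff)
qed

lemma admissible_if_short:
  assumes "length p \<le> 1"
  shows "admissible k u p"
  using assms
  by (cases p) (auto simp: admissible_def pre_digraph.awalk_verts.simps Let_def linear)

lemma path_mat_carrier:
  assumes "pre_digraph.cas G u p v" "set p \<subseteq> arcs G"
    and "\<And>a. a \<in> arcs G \<Longrightarrow> rmap V a \<in> carrier_mat (rdim V (head G a)) (rdim V (tail G a))"
  shows "path_mat G V u p \<in> carrier_mat (rdim V v) (rdim V u)"
  using assms(1,2)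
proof (induction p arbitrary: u)
  case (Cons a p)
  thus ?case using assms(3)[of a] by (auto simp: pre_digraph.cas.simps intro!: mult_carrier_mat)
qed (auto simp: pre_digraph.cas.simps)

lemma path_mat_zero_if_radical_square_zero:
  fixes V :: "('v, 'a, 'r::semiring_1) rep"
  assumes V: "\<And>a. a \<in> arcs G \<Longrightarrow> rmap V a \<in> carrier_mat (rdim V (head G a)) (rdim V (tail G a))"
    and sq: "\<And>a b. a \<in> arcs G \<Longrightarrow> b \<in> arcs G \<Longrightarrow> head G a = tail G b \<Longrightarrow>
      rmap V b * rmap V a = 0\<^sub>m (rdim V (head G b)) (rdim V (tail G a))"
    and walk: "pre_digraph.awalk G u p v" and long: "\<not> length p \<le> 1"
  shows "path_mat G V u p = 0\<^sub>m (rdim V v) (rdim V u)"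
proof -
  obtain a b p' where p: "p = a # b # p'"
    using long by (cases p; cases "tl p") auto
  have a: "a \<in> arcs G" and b: "b \<in> arcs G" and sub: "set p' \<subseteq> arcs G"
    and ends: "tail G a = u" "head G a = tail G b"
    and cas: "pre_digraph.cas G (head G b) p' v"
    using walk by (auto simp: p pre_digraph.awalk_def pre_digraph.cas.simps)
  let ?P = "path_mat G V (head G b) p'"
  have P: "?P \<in> carrier_mat (rdim V v) (rdim V (head G b))"
    by (rule path_mat_carrier[OF cas sub V])
  have "path_mat G V u p = ?P * (rmap V b * rmap V a)"
    using assoc_mult_mat[OF P V[OF b], of "rmap V a"] V[OF a] ends by (simp add: p)
  thus ?thesis using sq[OF a b ends(2)] P ends by simp
qed

text \<open>
  If every composite of two arrows acts as \<open>0\<close>, only paths of length at most one could violate a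
  relation; such paths are admissible, and each is the only admissible path between its ends.
\<close>

lemma is_rep_cube_if_radical_square_zero:
  fixes V :: "(real list, real list \<times> real list, 'r::ring_1) rep"
  assumes V: "\<And>a. a \<in> arcs (cube_quiver k) \<Longrightarrow>
      rmap V a \<in> carrier_mat (rdim V (snd a)) (rdim V (fst a))"
    and sq: "\<And>a b. a \<in> arcs (cube_quiver k) \<Longrightarrow> b \<in> arcs (cube_quiver k) \<Longrightarrow> snd a = fst b \<Longrightarrow>
      rmap V b * rmap V a = 0\<^sub>m (rdim V (snd b)) (rdim V (fst a))"
    and scale: "\<And>c. scale c 0 = 0"
  shows "is_rep scale (cube_quiver k) (cube_relations k) V"
proof -
  let ?G = "cube_quiver k"
  have zero: "path_mat ?G V u p = 0\<^sub>m (rdim V v) (rdim V u)"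
    if "pre_digraph.awalk ?G u p v" "\<not> length p \<le> 1" for u p v
    using path_mat_zero_if_radical_square_zero[of ?G V u p v] V sq that by simp
  have "\<forall>i<rdim V v. \<forall>j<rdim V u.
      (\<Sum>p\<in>Poly_Mapping.keys r. scale (Poly_Mapping.lookup r p) (path_mat ?G V u p $$ (i, j))) = 0"
    if rel: "(u, r, v) \<in> cube_relations k" for u r v
  proof -
    have "\<forall>p\<in>Poly_Mapping.keys r. path_mat ?G V u p = 0\<^sub>m (rdim V v) (rdim V u)"
      using rel unfolding cube_relations_def
    proof (elim UnE CollectE exE conjE)
      fix u' p v'
      assume "(u, r, v) = (u', Poly_Mapping.single p 1, v')"
        "pre_digraph.awalk ?G u' p v'" "\<not> admissible k u' p"
      thus ?thesis using zero[of u p v] admissible_if_short[of p k u] by auto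
    next
      fix u' p q v'
      assume eq: "(u, r, v) = (u', Poly_Mapping.single p 1 - Poly_Mapping.single q 1, v')"
        and w: "pre_digraph.awalk ?G u' p v'" "admissible k u' p"
          "pre_digraph.awalk ?G u' q v'" "admissible k u' q"
      show ?thesis
      proof (cases "p = q")
        case False
        hence "\<not> length p \<le> 1" "\<not> length q \<le> 1"
          using admissible_walk_unique_if_short w by metis+
        hence "path_mat ?G V u x = 0\<^sub>m (rdim V v) (rdim V u)" if "x \<in> {p, q}" for x
          using zero[of u x v] that w eq by auto
        moreover have "Poly_Mapping.keys r \<subseteq> {p, q}"
          using eq by (auto simp: in_keys_iff lookup_minus lookup_single when_def split: if_splits)
        ultimately show ?thesis by blast
      qed (use eq in simp)
    qed
    thus ?thesis by (simp add: scale)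
  qed
  thus ?thesis using V unfolding is_rep_def by auto
qed

section \<open>The bimodule\<close>

definition corner :: "nat \<Rightarrow> real \<Rightarrow> real \<Rightarrow> real \<Rightarrow> real list" where
  "corner k x y z = x # y # z # replicate (k - 3) 1"

text \<open>
  The arrows that act as \<open>1\<close>; they form a spanning tree of the ladder.
\<close>

definition tree_arcs :: "nat \<Rightarrow> (real list \<times> real list) set" where
  "tree_arcs k =
    {(corner k (-1) 1 1, corner k 1 1 1),
     (corner k 1 1 (-1), corner k 1 1 1),
     (corner k 1 (-1) 1, corner k 1 1 1),
     (corner k 1 1 (-1), corner k (-1) 1 (-1)),
     (corner k 1 1 (-1), corner k 1 (-1) (-1))}"

text \<open>
  The arrow on which a generator acts. Once the spanning tree identifies the spaces at all six
  vertices, this arrow becomes a loop.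
\<close>

definition loop_arc :: "nat \<Rightarrow> letter \<Rightarrow> real list \<times> real list" where
  "loop_arc k l = (case l of
     X_gen \<Rightarrow> (corner k (-1) 1 1, corner k (-1) 1 (-1))
   | Y_gen \<Rightarrow> (corner k 1 (-1) 1, corner k 1 (-1) (-1)))"

definition gen :: "letter \<Rightarrow> free_alg" where
  "gen l = Poly_Mapping.single (Free_Word [l]) 1"

definition arc_label :: "nat \<Rightarrow> real list \<times> real list \<Rightarrow> free_alg" where
  "arc_label k a =
    (if a \<in> tree_arcs k then 1
     else if a = loop_arc k X_gen then gen X_gen
     else if a = loop_arc k Y_gen then gen Y_gen
     else 0)"

definition ladder_sources :: "nat \<Rightarrow> real list set" where
  "ladder_sources k = {corner k (-1) 1 1, corner k 1 1 (-1), corner k 1 (-1) 1}"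

definition ladder_sinks :: "nat \<Rightarrow> real list set" where
  "ladder_sinks k = {corner k 1 1 1, corner k (-1) 1 (-1), corner k 1 (-1) (-1)}"

definition ladder_bimodule :: "nat \<Rightarrow> (real list, real list \<times> real list, free_alg) rep" where
  "ladder_bimodule k =
    (let d = \<lambda>v. if v \<in> ladder_sources k \<union> ladder_sinks k then 1 else 0
     in \<lparr>rdim = d, rmap = \<lambda>a. mat (d (snd a)) (d (fst a)) (\<lambda>_. arc_label k a)\<rparr>)"

lemma corner_eq_iff: "corner k x y z = corner k x' y' z' \<longleftrightarrow> x = x' \<and> y = y' \<and> z = z'"
  unfolding corner_def by simp

lemma sources_disjoint_sinks: "ladder_sources k \<inter> ladder_sinks k = {}"
  unfolding ladder_sources_def ladder_sinks_def by (simp add: corner_eq_iff)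

lemma ladder_subset_cube:
  assumes "k \<ge> 3"
  shows "ladder_sources k \<union> ladder_sinks k \<subseteq> cube_verts k"
  using assms unfolding ladder_sources_def ladder_sinks_def cube_verts_def corner_def
  by (auto simp: set_replicate_conv_if)

lemma flips_corner:
  assumes "k \<ge> 3"
  shows "flips (corner k x y z) (corner k x' y' z') k =
    (if x = x' then {} else {0}) \<union> (if y = y' then {} else {1}) \<union> (if z = z' then {} else {2})"
  (is "?L = ?R")
proof (rule Set.set_eqI)
  fix i
  consider "i = 0" | "i = 1" | "i = 2" | j where "i = Suc (Suc (Suc j))"
    by (metis One_nat_def Suc_1 not0_implies_Suc)
  thus "i \<in> ?L \<longleftrightarrow> i \<in> ?R"
    using assms by cases (auto simp: flips_def corner_def)
qed

lemma ladder_arcs: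
  assumes "k \<ge> 3"
  shows "tree_arcs k \<subseteq> arcs (cube_quiver k)" "loop_arc k l \<in> arcs (cube_quiver k)"
proof -
  have arc: "(u, v) \<in> arcs (cube_quiver k)"
    if "u \<in> ladder_sources k" "v \<in> ladder_sinks k" "card (flips u v k) = 1" for u v
    using that ladder_subset_cube[OF assms] unfolding cube_quiver_def flips_def by auto
  show "tree_arcs k \<subseteq> arcs (cube_quiver k)"
    unfolding tree_arcs_def
    by (intro insert_subsetI empty_subsetI arc)
      (simp_all add: ladder_sources_def ladder_sinks_def flips_corner[OF assms])
  show "loop_arc k l \<in> arcs (cube_quiver k)"
    unfolding loop_arc_def
    by (cases l) (auto intro!: arc
      simp: ladder_sources_def ladder_sinks_def flips_corner[OF assms])
qed

lemma arc_label_nonzero_ends: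
  assumes "arc_label k a \<noteq> 0"
  shows "fst a \<in> ladder_sources k" "snd a \<in> ladder_sinks k"
  using assms unfolding arc_label_def tree_arcs_def loop_arc_def ladder_sources_def ladder_sinks_def
  by (auto split: if_splits)

lemma is_rep_ladder_bimodule:
  "is_rep free_scale (cube_quiver k) (cube_relations k) (ladder_bimodule k)"
proof (rule is_rep_cube_if_radical_square_zero)
  let ?M = "ladder_bimodule k"
  show "rmap ?M a \<in> carrier_mat (rdim ?M (snd a)) (rdim ?M (fst a))" for a
    by (simp add: ladder_bimodule_def Let_def)
  show "rmap ?M b * rmap ?M a = 0\<^sub>m (rdim ?M (snd b)) (rdim ?M (fst a))"
    if "snd a = fst b" for a b
  proof -
    have "arc_label k a = 0 \<or> arc_label k b = 0"
      using arc_label_nonzero_ends[of k a] arc_label_nonzero_ends[of k b]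
        sources_disjoint_sinks[of k] that by auto
    thus ?thesis
      using that by (intro eq_matI) (auto simp: ladder_bimodule_def Let_def scalar_prod_def)
  qed
  show "free_scale c 0 = 0" for c
    by (rule poly_mapping_eqI) (simp add: Poly_Mapping.map.rep_eq when_def)
qed

section \<open>Tensoring with modules over the free algebra\<close>

lemma free_eval_carrier: "free_eval N f \<in> carrier_mat (rdim N ()) (rdim N ())"
  unfolding free_eval_def by simp

lemma free_eval_one: "free_eval N 1 = 1\<^sub>m (rdim N ())"
  unfolding free_eval_def
  by (intro eq_matI) (simp_all add: zero_free_word_def lookup_one)

lemma free_eval_gen:
  assumes "is_crep two_loops {} N"
  shows "free_eval N (gen l) = rmap N l"
proof -
  have "rmap N l \<in> carrier_mat (rdim N ()) (rdim N ())"
    using assms by (simp add: is_crep_two_loops)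
  thus ?thesis unfolding free_eval_def gen_def by (intro eq_matI) auto
qed

lemma rdim_tensor_ladder:
  "rdim (tensor_rep (ladder_bimodule k) N) v =
    (if v \<in> ladder_sources k \<union> ladder_sinks k then rdim N () else 0)"
  by (simp add: tensor_rep_def ladder_bimodule_def Let_def)

lemma rmap_tensor_carrier:
  "rmap (tensor_rep (ladder_bimodule k) N) a \<in> carrier_mat
    (rdim (tensor_rep (ladder_bimodule k) N) (snd a))
    (rdim (tensor_rep (ladder_bimodule k) N) (fst a))"
  by (simp add: tensor_rep_def ladder_bimodule_def Let_def)

lemma rmap_tensor_ladder:
  assumes "arc_label k a \<noteq> 0"
  shows "rmap (tensor_rep (ladder_bimodule k) N) a = free_eval N (arc_label k a)"
  using arc_label_nonzero_ends[OF assms] free_eval_carrier[of N "arc_label k a"]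
  by (intro eq_matI) (auto simp: tensor_rep_def ladder_bimodule_def Let_def)

lemma rmap_tensor_tree:
  assumes "a \<in> tree_arcs k"
  shows "rmap (tensor_rep (ladder_bimodule k) N) a = 1\<^sub>m (rdim N ())"
proof -
  have "arc_label k a = 1" using assms by (simp add: arc_label_def)
  thus ?thesis by (simp add: rmap_tensor_ladder free_eval_one)
qed

lemma rmap_tensor_loop:
  assumes "is_crep two_loops {} N"
  shows "rmap (tensor_rep (ladder_bimodule k) N) (loop_arc k l) = rmap N l"
proof -
  have lab: "arc_label k (loop_arc k l) = gen l"
    by (cases l) (auto simp: arc_label_def loop_arc_def tree_arcs_def corner_eq_iff)
  have "gen l \<noteq> 0" unfolding gen_def by (metis lookup_single_eq lookup_zero zero_neq_one)
  thus ?thesis using lab by (simp add: rmap_tensor_ladder free_eval_gen[OF assms])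
qed

text \<open>
  The functor \<open>M \<otimes> _\<close> is fully faithful: along an arrow that acts as \<open>1\<close> the components of \<open>f\<close> at
  both ends agree, so the spanning tree makes all components equal, and commutation with the
  arrows labelled by the generators is then the condition for a module homomorphism.
\<close>

lemma hom_tensor_ladder:
  fixes N N' :: "(unit, letter, complex) rep"
  assumes k: "k \<ge> 3" and N: "is_crep two_loops {} N" and N': "is_crep two_loops {} N'"
    and f: "rep_hom (cube_quiver k) (tensor_rep (ladder_bimodule k) N)
      (tensor_rep (ladder_bimodule k) N') f"
  shows "\<And>v. v \<in> ladder_sources k \<union> ladder_sinks k \<Longrightarrow> f v = f (corner k 1 1 1)"
    and "\<And>l. f (corner k 1 1 1) * rmap N l = rmap N' l * f (corner k 1 1 1)"
proof -
  have fc: "f v \<in> carrier_mat (rdim N' ()) (rdim N ())"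
    if "v \<in> ladder_sources k \<union> ladder_sinks k" for v
    proof -
    have "v \<in> verts (cube_quiver k)" using subsetD[OF ladder_subset_cube[OF k] that] by simp
    hence "f v \<in> carrier_mat (rdim (tensor_rep (ladder_bimodule k) N') v)
        (rdim (tensor_rep (ladder_bimodule k) N) v)"
      using f unfolding rep_hom_def by blast
    thus ?thesis using that by (simp add: rdim_tensor_ladder)
  qed
  have comm: "f (snd a) * rmap (tensor_rep (ladder_bimodule k) N) a =
      rmap (tensor_rep (ladder_bimodule k) N') a * f (fst a)" if "a \<in> arcs (cube_quiver k)" for a
    using f that unfolding rep_hom_def by simp
  have tree: "f (snd a) = f (fst a)" if a: "a \<in> tree_arcs k" for a
  proof -
    have "arc_label k a \<noteq> 0" using a by (simp add: arc_label_def)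
    note ends = arc_label_nonzero_ends[OF this]
    show ?thesis
      using comm[of a] a ladder_arcs(1)[OF k] fc[of "fst a"] fc[of "snd a"] ends
      by (auto simp: rmap_tensor_tree)
  qed
  show diag: "f v = f (corner k 1 1 1)" if "v \<in> ladder_sources k \<union> ladder_sinks k" for v
  proof -
    have "f t = f s" if "(s, t) \<in> tree_arcs k" for s t using tree[OF that] by simp
    hence "f (corner k 1 1 1) = f (corner k (-1) 1 1)" "f (corner k 1 1 1) = f (corner k 1 1 (-1))"
      "f (corner k 1 1 1) = f (corner k 1 (-1) 1)"
      "f (corner k (-1) 1 (-1)) = f (corner k 1 1 (-1))"
      "f (corner k 1 (-1) (-1)) = f (corner k 1 1 (-1))"
      by (simp_all add: tree_arcs_def)
    thus ?thesis using that unfolding ladder_sources_def ladder_sinks_def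
      by (elim UnE insertE emptyE) simp_all
  qed
  show "f (corner k 1 1 1) * rmap N l = rmap N' l * f (corner k 1 1 1)" for l
  proof -
    have "fst (loop_arc k l) \<in> ladder_sources k" "snd (loop_arc k l) \<in> ladder_sinks k"
      by (cases l; simp add: loop_arc_def ladder_sources_def ladder_sinks_def)+
    thus ?thesis
      using comm[OF ladder_arcs(2)[OF k, of l]] diag
      by (simp add: rmap_tensor_loop[OF N] rmap_tensor_loop[OF N'])
  qed
qed

theorem lemma2p11:
  fixes k :: nat
  assumes "k \<ge> 3"
  shows "wild (cube_quiver k) (cube_relations k)"
  unfolding wild_def
proof (intro exI[of _ "ladder_bimodule k"] conjI allI impI)
  show "is_rep free_scale (cube_quiver k) (cube_relations k) (ladder_bimodule k)"
    by (rule is_rep_ladder_bimodule)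
  let ?b = "corner k 1 1 1"
  have b: "?b \<in> ladder_sources k \<union> ladder_sinks k" by (simp add: ladder_sinks_def)
  hence b': "?b \<in> verts (cube_quiver k)" using ladder_subset_cube[OF assms] by auto
  show "indecomposable_rep (cube_quiver k) (cube_relations k) (tensor_rep (ladder_bimodule k) N)"
    if N: "is_crep two_loops {} N" and ind: "indecomposable_rep two_loops {} N" for N
  proof (rule indecomposable_rep_if_endomorphisms_diagonal[OF _ _ N ind b'])
    fix f v
    assume f: "rep_hom (cube_quiver k) (tensor_rep (ladder_bimodule k) N)
        (tensor_rep (ladder_bimodule k) N) f"
    show "f ?b * rmap N l = rmap N l * f ?b" for l
      by (rule hom_tensor_ladder(2)[OF assms N N f])
    show "f v = f ?b" if "rdim (tensor_rep (ladder_bimodule k) N) v \<noteq> 0"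
      using hom_tensor_ladder(1)[OF assms N N f] that
      by (auto simp: rdim_tensor_ladder split: if_splits)
  qed (use b cube_arc_ends rmap_tensor_carrier in \<open>auto simp: rdim_tensor_ladder\<close>)
  show "iso_rep two_loops N N'"
    if N: "is_crep two_loops {} N" and N': "is_crep two_loops {} N'"
      and iso: "iso_rep (cube_quiver k) (tensor_rep (ladder_bimodule k) N)
        (tensor_rep (ladder_bimodule k) N')" for N N'
  proof -
    from iso obtain f where f: "rep_hom (cube_quiver k) (tensor_rep (ladder_bimodule k) N)
        (tensor_rep (ladder_bimodule k) N') f" and inv: "invertible_mat (f ?b)"
      unfolding iso_rep_iff_rep_hom using b' by blast
    have "f ?b \<in> carrier_mat (rdim N' ()) (rdim N ())"
      using f b b' unfolding rep_hom_def by (auto simp: rdim_tensor_ladder)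
    thus ?thesis
      unfolding iso_rep_def using inv hom_tensor_ladder(2)[OF assms N N' f]
      by (intro exI[of _ "\<lambda>_. f ?b"]) simp
  qed
qed

end
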